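(* Let $k$ be a nonnegative integer, let $G=(V,E)$ be a connected graph and let $X\subseteq V$. Then \[\gamma_{P,k}(G/X)-1\leq \gamma_{P,k}(G)\leq \gamma_{P,k}(G/X)+\gamma_{P,k}(\widehat X).\] Moreover, both bounds are tight: for every positive integer $k$ there exist a connected graph $G$ and $X\subseteq V(G)$ with $\gamma_{P,k}(G)=\gamma_{P,k}(G/X)+\gamma_{P,k}(\widehat X)$, and there exist a connected graph $G$ and $X\subseteq V(G)$ with $\gamma_{P,k}(G)=\gamma_{P,k}(G/X)-1$.
   Context: Graphs are finite, simple and undirected; $N_G(v)$ is the open neighborhood, $N_G[S]=\bigcup_{v\in S}(N_G(v)\cup\{v\})$. For $X\subseteq V$, the contraction $G/X$ is the graph obtained from $G-X$ by adding a new vertex $v_X$ with $N_{G/X}(v_X)=N_G[X]\setminus X$ ($G[X]$ need not be connected). $\widehat X$ is the graph obtained from the induced subgraph $G[X]$ by attaching to each vertex $x\in X$ as many new pendent vertices as $x$ has neighbors in $G-X$. For a graph $G=(V,E)$, nonnegative integer $k$ and $S\subseteq V$, define $\mathscr P^0_{G,k}(S)=N[S]$ and $\mathscr P^{i+1}_{G,k}(S)=\mathscr P^i_{G,k}(S)\cup\bigcup\{N(v): v\in \mathscr P^i_{G,k}(S),\ 1\le |N(v)\setminus \mathscr P^i_{G,k}(S)|\le k\}$. $S$ is a $k$-power dominating set of $G$ if $\mathscr P^\ell_{G,k}(S)=V$ for some $\ell$; $\gamma_{P,k}(G)$ is the minimum size of such a set. *)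

theory Defs
  imports "Graph_Theory.Graph_Theory"
begin

text \<open>
  A finite simple undirected graph is a value \<open>G\<close> satisfying \<^locale>\<open>pair_graph\<close>: a finite vertex
  set with a symmetric irreflexive arc relation, an edge \<open>{u, v}\<close> being the two arcs
  \<open>(u, v)\<close> and \<open>(v, u)\<close>.
\<close>

definition nbhd :: "'a pair_pre_digraph \<Rightarrow> 'a \<Rightarrow> 'a set" where
  "nbhd G v = {u. (v, u) \<in> parcs G}"

definition closed_nbhd :: "'a pair_pre_digraph \<Rightarrow> 'a set \<Rightarrow> 'a set" where
  "closed_nbhd G S = (\<Union>v\<in>S. nbhd G v \<union> {v})"

primrec monitored :: "'a pair_pre_digraph \<Rightarrow> nat \<Rightarrow> 'a set \<Rightarrow> nat \<Rightarrow> 'a set" where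
  "monitored G k S 0 = closed_nbhd G S"
| "monitored G k S (Suc i) = monitored G k S i \<union>
     \<Union>{nbhd G v | v. v \<in> monitored G k S i \<and>
        1 \<le> card (nbhd G v - monitored G k S i) \<and>
        card (nbhd G v - monitored G k S i) \<le> k}"

definition power_dominating :: "'a pair_pre_digraph \<Rightarrow> nat \<Rightarrow> 'a set \<Rightarrow> bool" where
  "power_dominating G k S \<longleftrightarrow> S \<subseteq> pverts G \<and> (\<exists>l. monitored G k S l = pverts G)"

definition power_dom_num :: "nat \<Rightarrow> 'a pair_pre_digraph \<Rightarrow> nat" where
  "power_dom_num k G = Min (card ` {S. power_dominating G k S})"

text \<open>In \<open>contraction G X\<close> the new vertex is \<^const>\<open>None\<close>.\<close>

definition contraction :: "'a pair_pre_digraph \<Rightarrow> 'a set \<Rightarrow> 'a option pair_pre_digraph" where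
  "contraction G X = \<lparr>
     pverts = insert None (Some ` (pverts G - X)),
     parcs = {(Some u, Some v) | u v. (u, v) \<in> parcs G \<and> u \<notin> X \<and> v \<notin> X}
       \<union> {(None, Some w) | w. w \<in> closed_nbhd G X - X}
       \<union> {(Some w, None) | w. w \<in> closed_nbhd G X - X} \<rparr>"

text \<open>
  In \<open>pendent_ext G X\<close> the vertices of \<open>G[X]\<close> are \<open>Inl x\<close>. The pendent vertices attached to \<open>x\<close>
  are \<open>Inr (x, y)\<close>, one for each neighbour \<open>y\<close> of \<open>x\<close> outside \<open>X\<close>.
\<close>

definition pendent_ext :: "'a pair_pre_digraph \<Rightarrow> 'a set \<Rightarrow> ('a + 'a \<times> 'a) pair_pre_digraph" where
  "pendent_ext G X = \<lparr>
     pverts = Inl ` X \<union> {Inr (x, y) | x y. x \<in> X \<and> y \<in> nbhd G x - X},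
     parcs = {(Inl u, Inl v) | u v. (u, v) \<in> parcs G \<and> u \<in> X \<and> v \<in> X}
       \<union> {(Inl x, Inr (x, y)) | x y. x \<in> X \<and> y \<in> nbhd G x - X}
       \<union> {(Inr (x, y), Inl x) | x y. x \<in> X \<and> y \<in> nbhd G x - X} \<rparr>"

lemma pair_graphI:
  assumes "finite (pverts G)" and "parcs G \<subseteq> pverts G \<times> pverts G"
    and "sym (parcs G)" and "irrefl (parcs G)"
  shows "pair_graph G"
proof -
  have "finite (parcs G)"
    using assms(1,2) by (meson finite_SigmaI finite_subset)
  with assms show ?thesis
    by unfold_locales (auto simp: symmetric_def irrefl_def)
qed

lemma
  assumes "pair_graph G"
  shows finite_nbhd: "finite (nbhd G v)" and nbhd_subset: "nbhd G v \<subseteq> pverts G"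
proof -
  interpret pair_graph G by fact
  show "nbhd G v \<subseteq> pverts G" by (auto simp: nbhd_def dest: in_arcsD2)
  then show "finite (nbhd G v)" using pair_finite_verts finite_subset by blast
qed

lemma pair_graph_contraction:
  assumes "pair_graph G" and "X \<subseteq> pverts G"
  shows "pair_graph (contraction G X)"
proof -
  interpret pair_graph G by fact
  show ?thesis
    using assms(2) pair_finite_verts
    by (intro pair_graphI)
      (auto simp: contraction_def closed_nbhd_def nbhd_def sym_def irrefl_def
        intro: arcs_symmetric dest: in_arcsD1 in_arcsD2 no_loops')
qed

lemma nbhd_contraction_None: "nbhd (contraction G X) None = Some ` (closed_nbhd G X - X)"
  by (auto simp: nbhd_def contraction_def)

lemma pair_graph_pendent_ext:
  assumes "pair_graph G" and "X \<subseteq> pverts G"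
  shows "pair_graph (pendent_ext G X)"
proof -
  interpret pair_graph G by fact
  have "{Inr (x, y) | x y. x \<in> X \<and> y \<in> nbhd G x - X} \<subseteq> Inr ` (pverts G \<times> pverts G)"
    using assms(2) nbhd_subset[OF assms(1)] by auto
  then have "finite {Inr (x, y) :: 'a + 'a \<times> 'a | x y. x \<in> X \<and> y \<in> nbhd G x - X}"
    by (rule finite_subset) (simp add: pair_finite_verts)
  moreover have "finite X" using assms(2) pair_finite_verts finite_subset by blast
  ultimately show ?thesis
    by (intro pair_graphI)
      (auto simp: pendent_ext_def sym_def irrefl_def intro: arcs_symmetric dest: no_loops')
qed

lemma
  assumes "pair_graph G"
  shows power_dom_num_le: "power_dominating G k S \<Longrightarrow> power_dom_num k G \<le> card S"
    and power_dom_num_attained: "\<exists>S. power_dominating G k S \<and> card S = power_dom_num k G"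
proof -
  interpret pair_graph G by fact
  have "{S. power_dominating G k S} \<subseteq> Pow (pverts G)"
    by (auto simp: power_dominating_def)
  then have fin: "finite (card ` {S. power_dominating G k S})"
    by (meson finite_imageI finite_Pow_iff finite_subset pair_finite_verts)
  then show "power_dominating G k S \<Longrightarrow> power_dom_num k G \<le> card S"
    unfolding power_dom_num_def by (intro Min_le) auto
  have "monitored G k (pverts G) 0 = pverts G"
    using nbhd_subset[OF assms] by (auto simp: closed_nbhd_def)
  then have "power_dominating G k (pverts G)"
    unfolding power_dominating_def by blast
  then have "power_dom_num k G \<in> card ` {S. power_dominating G k S}"
    unfolding power_dom_num_def using fin by (intro Min_in) auto
  then show "\<exists>S. power_dominating G k S \<and> card S = power_dom_num k G" by force
qed

end

theory Submission
  imports Defs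
begin

text \<open>
  A set \<open>S\<close> is power dominating iff every propagation-closed set containing \<open>N[S]\<close> contains all
  vertices, so each inequality reduces to transporting propagation-closed sets between the graphs.
  If \<open>D\<close> power dominates \<open>G\<close>, then \<open>D - X\<close> together with the new vertex power dominates \<open>G/X\<close>.
  Conversely, take a power dominating set of \<open>G/X\<close> without its new vertex, and one of the pendent
  extension with each pendent vertex replaced by its neighbour in \<open>X\<close>; the latter already
  monitors \<open>N[X]\<close> in \<open>G\<close>, and from then on the monitoring of \<open>G/X\<close> can be imitated.

  For tightness, more than \<open>k\<close> leaves with a common neighbour \<open>c\<close> force every power dominating set
  to meet \<open>c\<close> or one of these leaves. The upper bound is attained by two adjacent centres with
  \<open>k + 1\<close> leaves each, contracting one star. The lower bound is attained by a root with \<open>k + 1\<close>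
  leaves and two further children with \<open>k\<close> leaves each, contracting those two children to a single
  vertex with \<open>2 k > k\<close> leaves.
\<close>

section \<open>Propagation-closed sets and their relation to power domination\<close>

text \<open>For finite neighbourhoods, cardinality 0 makes the implication trivial. \<open>A\<close>
  may contain non-vertices, so that complements like \<open>- L\<close> qualify.\<close>

definition propagation_closed :: "'a pair_pre_digraph \<Rightarrow> nat \<Rightarrow> 'a set \<Rightarrow> bool" where
  "propagation_closed G k A \<longleftrightarrow> (\<forall>v\<in>A. card (nbhd G v - A) \<le> k \<longrightarrow> nbhd G v \<subseteq> A)"

lemma closed_nbhd_subset_iff:
  "closed_nbhd G S \<subseteq> A \<longleftrightarrow> S \<subseteq> A \<and> (\<forall>v\<in>S. nbhd G v \<subseteq> A)"
  by (auto simp: closed_nbhd_def)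

lemma monitored_mono: "i \<le> j \<Longrightarrow> monitored G k S i \<subseteq> monitored G k S j"
  by (rule lift_Suc_mono_le[of "monitored G k S"]) auto

text \<open>The stages form an increasing chain, so the latest of the finitely many stages at which
  elements of \<open>F\<close> appear contains all of \<open>F\<close>.\<close>

lemma finite_subset_monitored:
  assumes "finite F" and "F \<subseteq> (\<Union>i. monitored G k S i)"
  shows "\<exists>i. F \<subseteq> monitored G k S i"
  using assms
proof (induction rule: finite_subset_induct')
  case (insert w F)
  then obtain i j where "F \<subseteq> monitored G k S i" "w \<in> monitored G k S j" by blast
  then have "insert w F \<subseteq> monitored G k S (max i j)"
    using monitored_mono[of i "max i j" G k S] monitored_mono[of j "max i j" G k S] by auto
  then show ?case by blast
qed simp

text \<open>Passing from a stage to the larger set \<open>A\<close> can only reduce the number of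
  missing neighbours, so any vertex allowed to propagate at that stage may also propagate in
  \<open>A\<close>.\<close>

lemma monitored_subset:
  assumes "pair_graph G" and "propagation_closed G k A" and "closed_nbhd G S \<subseteq> A"
  shows "monitored G k S i \<subseteq> A"
proof (induction i)
  case (Suc i)
  have "nbhd G v \<subseteq> A"
    if "v \<in> monitored G k S i" "card (nbhd G v - monitored G k S i) \<le> k" for v
  proof -
    have "card (nbhd G v - A) \<le> card (nbhd G v - monitored G k S i)"
      using Suc finite_nbhd[OF assms(1)] by (intro card_mono) auto
    then show ?thesis
      using assms(2) that Suc by (force simp: propagation_closed_def)
  qed
  then show ?case using Suc by auto
qed (use assms in simp)

lemma propagation_closed_UN_monitored:
  assumes "pair_graph G"
  shows "propagation_closed G k (\<Union>i. monitored G k S i)" (is "propagation_closed G k ?M")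
  unfolding propagation_closed_def
proof (intro ballI impI)
  fix v assume "v \<in> ?M" and card: "card (nbhd G v - ?M) \<le> k"
  \<comment> \<open>One stage holds \<open>v\<close> together with its finitely many neighbours in
    \<open>?M\<close>. At that stage \<open>v\<close> misses exactly what it misses from the whole
    union, so the next stage absorbs the rest.\<close>
  have "finite (insert v (nbhd G v \<inter> ?M))"
    using finite_nbhd[OF assms] by blast
  moreover have "insert v (nbhd G v \<inter> ?M) \<subseteq> ?M"
    using \<open>v \<in> ?M\<close> by blast
  ultimately obtain i where i: "insert v (nbhd G v \<inter> ?M) \<subseteq> monitored G k S i"
    using finite_subset_monitored by metis
  then have eq: "nbhd G v - monitored G k S i = nbhd G v - ?M" by blast
  show "nbhd G v \<subseteq> ?M"
  proof (cases "nbhd G v - ?M = {}")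
    case False
    then have "1 \<le> card (nbhd G v - ?M)"
      using finite_nbhd[OF assms] by (simp add: Suc_le_eq card_gt_0_iff)
    then have "nbhd G v \<subseteq> monitored G k S (Suc i)"
      using i card unfolding monitored.simps eq[symmetric] by blast
    then show ?thesis by blast
  qed blast
qed

text \<open>The union of the stages is the least propagation-closed set containing
  \<open>closed_nbhd G S\<close>. Finiteness of the vertex set turns covering by the union into
  covering by a single stage, and \<open>pverts G\<close>, itself closed, bounds every stage from
  above.\<close>

lemma power_dominating_iff:
  assumes "pair_graph G"
  shows "power_dominating G k S \<longleftrightarrow> S \<subseteq> pverts G \<and>
    (\<forall>A. propagation_closed G k A \<longrightarrow> closed_nbhd G S \<subseteq> A \<longrightarrow> pverts G \<subseteq> A)"
proof
  assume "power_dominating G k S"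
  then show "S \<subseteq> pverts G \<and>
    (\<forall>A. propagation_closed G k A \<longrightarrow> closed_nbhd G S \<subseteq> A \<longrightarrow> pverts G \<subseteq> A)"
    unfolding power_dominating_def using monitored_subset[OF assms] by metis
next
  interpret pair_graph G by fact
  let ?M = "\<Union>i. monitored G k S i"
  assume R: "S \<subseteq> pverts G \<and>
    (\<forall>A. propagation_closed G k A \<longrightarrow> closed_nbhd G S \<subseteq> A \<longrightarrow> pverts G \<subseteq> A)"
  have closed: "closed_nbhd G S \<subseteq> ?M"
    by (metis UN_upper UNIV_I monitored.simps(1))
  have sub: "pverts G \<subseteq> ?M"
    using R propagation_closed_UN_monitored[OF assms] closed by blast
  then obtain i where "pverts G \<subseteq> monitored G k S i"
    using finite_subset_monitored[OF pair_finite_verts] by blast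
  moreover have "monitored G k S i \<subseteq> pverts G"
  proof (rule monitored_subset[OF assms])
    show "propagation_closed G k (pverts G)"
      using nbhd_subset[OF assms] by (auto simp: propagation_closed_def)
    show "closed_nbhd G S \<subseteq> pverts G"
      using nbhd_subset[OF assms] R by (auto simp: closed_nbhd_subset_iff)
  qed
  ultimately show "power_dominating G k S"
    using R unfolding power_dominating_def by blast
qed

lemma finite_power_dominating:
  assumes "pair_graph G" and "power_dominating G k S"
  shows "finite S"
proof -
  interpret pair_graph G by fact
  show ?thesis
    using assms(2) by (metis power_dominating_def finite_subset pair_finite_verts)
qed

section \<open>The two inequalities between the power domination numbers\<close>

lemma nbhd_contraction_Some:
  "v \<notin> X \<Longrightarrow> nbhd (contraction G X) (Some v) =
     Some ` (nbhd G v - X) \<union> (if v \<in> closed_nbhd G X then {None} else {})"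
  by (auto simp: nbhd_def contraction_def)

lemma nbhd_pendent_ext_Inl:
  "x \<in> X \<Longrightarrow> nbhd (pendent_ext G X) (Inl x) = Inl ` (nbhd G x \<inter> X) \<union> (\<lambda>y. Inr (x, y)) ` (nbhd G x - X)"
  by (auto simp: nbhd_def pendent_ext_def)

text \<open>Only an inclusion, because the neighbourhood is empty when \<open>(x, y)\<close> names
  no pendent vertex.\<close>

lemma nbhd_pendent_ext_Inr:
  "nbhd (pendent_ext G X) (Inr (x, y)) \<subseteq> {Inl x}"
  by (auto simp: nbhd_def pendent_ext_def)

lemma power_dom_num_contraction_le:
  assumes G: "pair_graph G" and X: "X \<subseteq> pverts G"
  shows "power_dom_num k (contraction G X) \<le> power_dom_num k G + 1"
proof -
  let ?H = "contraction G X"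
  have H: "pair_graph ?H" by (rule pair_graph_contraction[OF G X])
  obtain D where D: "power_dominating G k D" "card D = power_dom_num k G"
    using power_dom_num_attained[OF G] by blast
  have DV: "D \<subseteq> pverts G" using D(1) by (simp add: power_dominating_def)
  have finD: "finite D" by (rule finite_power_dominating[OF G D(1)])
  let ?D = "insert None (Some ` (D - X))"
  have "power_dominating ?H k ?D"
    unfolding power_dominating_iff[OF H]
  proof (intro conjI allI impI)
    show "?D \<subseteq> pverts ?H" using DV by (auto simp: contraction_def)
    fix B assume B: "propagation_closed ?H k B" "closed_nbhd ?H ?D \<subseteq> B"
    \<comment> \<open>The preimage of \<open>B\<close> with all of \<open>X\<close> added. As
      \<open>None\<close> is in \<open>?D\<close>, the whole of \<open>closed_nbhd G X\<close> lies
      in \<open>A\<close>, so vertices of \<open>X\<close> have no missing neighbours.\<close>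
    define A where "A = X \<union> {v. Some v \<in> B}"
    have "None \<in> B" and NX: "Some ` (closed_nbhd G X - X) \<subseteq> B"
      using B(2) by (auto simp: closed_nbhd_subset_iff nbhd_contraction_None)
    then have A: "closed_nbhd G X \<subseteq> A" by (auto simp: A_def)
    have BA: "Some ` (C - X) \<subseteq> B \<longleftrightarrow> C \<subseteq> A" for C by (auto simp: A_def)
    have "closed_nbhd G D \<subseteq> A"
      unfolding closed_nbhd_subset_iff
    proof (intro conjI ballI)
      show "D \<subseteq> A" using B(2) by (auto simp: closed_nbhd_subset_iff A_def)
      fix v assume "v \<in> D"
      show "nbhd G v \<subseteq> A"
      proof (cases "v \<in> X")
        case True
        then show ?thesis using A by (auto simp: closed_nbhd_subset_iff)
      next
        case False
        with \<open>v \<in> D\<close> have "nbhd ?H (Some v) \<subseteq> B"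
          using B(2) by (auto simp: closed_nbhd_subset_iff)
        with False show ?thesis unfolding BA[symmetric] by (simp add: nbhd_contraction_Some)
      qed
    qed
    moreover have "propagation_closed G k A"
      unfolding propagation_closed_def
    proof (intro ballI impI)
      fix v assume v: "v \<in> A" "card (nbhd G v - A) \<le> k"
      show "nbhd G v \<subseteq> A"
      proof (cases "v \<in> X")
        case True
        then show ?thesis using A by (auto simp: closed_nbhd_subset_iff)
      next
        case False
        \<comment> \<open>Missing neighbours lie outside \<open>X\<close> on both sides, since
          \<open>None\<close> is in \<open>B\<close> and \<open>X\<close> is contained in
          \<open>A\<close>. Hence \<open>v\<close> faces the same count in both graphs.\<close>
        have "nbhd ?H (Some v) - B = Some ` (nbhd G v - A)"
          using \<open>None \<in> B\<close> False by (auto simp: nbhd_contraction_Some A_def)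
        then have "card (nbhd ?H (Some v) - B) \<le> k"
          using v(2) by (simp add: card_image)
        then have "nbhd ?H (Some v) \<subseteq> B"
          using B(1) v(1) False by (auto simp: propagation_closed_def A_def)
        with False show ?thesis unfolding BA[symmetric] by (simp add: nbhd_contraction_Some)
      qed
    qed
    ultimately have "pverts G \<subseteq> A"
      using D(1) by (auto simp: power_dominating_iff[OF G])
    then show "pverts ?H \<subseteq> B"
      using \<open>None \<in> B\<close> by (auto simp: contraction_def A_def)
  qed
  then have "power_dom_num k ?H \<le> card ?D" by (rule power_dom_num_le[OF H])
  also have "\<dots> \<le> card (Some ` (D - X)) + 1" using finD by (simp add: card_insert_if)
  also have "\<dots> \<le> card D + 1"
    using finD by (simp add: card_image card_mono)
  finally show ?thesis using D(2) by simp
qed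

lemma power_dom_num_le_contraction:
  assumes G: "pair_graph G" and X: "X \<subseteq> pverts G"
  shows "power_dom_num k G \<le> power_dom_num k (contraction G X) + power_dom_num k (pendent_ext G X)"
proof -
  let ?H = "contraction G X" and ?P = "pendent_ext G X"
  have H: "pair_graph ?H" by (rule pair_graph_contraction[OF G X])
  have P: "pair_graph ?P" by (rule pair_graph_pendent_ext[OF G X])
  obtain D where D: "power_dominating ?H k D" "card D = power_dom_num k ?H"
    using power_dom_num_attained[OF H] by blast
  obtain T where T: "power_dominating ?P k T" "card T = power_dom_num k ?P"
    using power_dom_num_attained[OF P] by blast
  have DV: "D \<subseteq> pverts ?H" and TV: "T \<subseteq> pverts ?P"
    using D(1) T(1) by (auto simp: power_dominating_def)
  have finD: "finite D" by (rule finite_power_dominating[OF H D(1)])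
  have finT: "finite T" by (rule finite_power_dominating[OF P T(1)])
  \<comment> \<open>\<open>?D\<close> drops the new vertex. \<open>?T\<close> keeps the vertices of
    \<open>X\<close> and moves each pendent vertex \<open>Inr (x, y)\<close> to its support
    \<open>x\<close>.\<close>
  let ?D = "the ` (D - {None})" and ?T = "case_sum id fst ` T"
  have "power_dominating G k (?D \<union> ?T)"
    unfolding power_dominating_iff[OF G]
  proof (intro conjI allI impI)
    show "?D \<union> ?T \<subseteq> pverts G"
      using DV TV X by (force simp: contraction_def pendent_ext_def)
    fix A assume A: "propagation_closed G k A" "closed_nbhd G (?D \<union> ?T) \<subseteq> A"
    \<comment> \<open>A pendent vertex \<open>Inr (x, y)\<close> stands for the outside neighbour
      \<open>y\<close>. Requiring \<open>x\<close> in \<open>A\<close> as well leaves pendent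
      vertices with nothing to propagate.\<close>
    define B where "B = Inl ` (X \<inter> A) \<union> Inr ` ((X \<inter> A) \<times> A)"
    have TX: "x \<in> X" if "Inl x \<in> T" for x
      using subsetD[OF TV that] by (auto simp: pendent_ext_def)
    have TX': "x \<in> X \<and> y \<in> nbhd G x" if "Inr (x, y) \<in> T" for x y
      using subsetD[OF TV that] by (auto simp: pendent_ext_def)
    have TA: "x \<in> A \<and> nbhd G x \<subseteq> A" if "Inl x \<in> T" for x
      using A(2) image_eqI[of x "case_sum id fst", OF _ that]
      by (auto simp: closed_nbhd_subset_iff)
    have TA': "x \<in> A \<and> nbhd G x \<subseteq> A" if "Inr (x, y) \<in> T" for x y
      using A(2) image_eqI[of x "case_sum id fst", OF _ that]
      by (auto simp: closed_nbhd_subset_iff)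
    have "closed_nbhd ?P T \<subseteq> B"
      unfolding closed_nbhd_subset_iff
    proof (intro conjI ballI)
      show "T \<subseteq> B"
      proof
        fix v assume v: "v \<in> T"
        show "v \<in> B"
        proof (cases v)
          case (Inl x)
          then show ?thesis using v TX TA[of x] by (simp add: B_def)
        next
          case (Inr p)
          obtain x y where "p = (x, y)" by (cases p)
          then show ?thesis using v Inr TX'[of x y] TA'[of x y] by (auto simp: B_def)
        qed
      qed
      fix v assume v: "v \<in> T"
      show "nbhd ?P v \<subseteq> B"
      proof (cases v)
        case (Inl x)
        then show ?thesis using v TX[of x] TA[of x] by (auto simp: B_def nbhd_pendent_ext_Inl)
      next
        case (Inr p)
        obtain x y where "p = (x, y)" by (cases p)
        then show ?thesis
          using v Inr TX'[of x y] TA'[of x y] nbhd_pendent_ext_Inr[of G X x y] by (auto simp: B_def)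
      qed
    qed
    moreover have "propagation_closed ?P k B"
      unfolding propagation_closed_def
    proof (intro ballI impI)
      fix v assume v: "v \<in> B" "card (nbhd ?P v - B) \<le> k"
      show "nbhd ?P v \<subseteq> B"
      proof (cases v)
        case (Inl x)
        then have x: "x \<in> X" "x \<in> A" using v(1) by (auto simp: B_def)
        \<comment> \<open>The same \<open>y\<close> may occur at several supports, but the pendent
          vertices at one \<open>x\<close> have distinct \<open>y\<close>. So \<open>x\<close>
          misses equally many neighbours in \<open>?P\<close> and in \<open>G\<close>.\<close>
        let ?f = "\<lambda>y. if y \<in> X then Inl y else Inr (x, y)"
        have "nbhd ?P v - B = ?f ` (nbhd G x - A)"
          using x by (auto simp: Inl nbhd_pendent_ext_Inl B_def)
        moreover have "inj_on ?f (nbhd G x - A)"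
          by (auto simp: inj_on_def split: if_splits)
        ultimately have "card (nbhd G x - A) \<le> k"
          using v(2) by (simp only: card_image)
        then have "nbhd G x \<subseteq> A" using A(1) x by (auto simp: propagation_closed_def)
        then show ?thesis using x by (auto simp: Inl nbhd_pendent_ext_Inl B_def)
      next
        case (Inr p)
        then show ?thesis using v(1) nbhd_pendent_ext_Inr[of G X] by (cases p) (auto simp: B_def)
      qed
    qed
    \<comment> \<open>As \<open>T\<close> power dominates \<open>?P\<close>, \<open>B\<close>
      contains every vertex of \<open>?P\<close>. Its copies of \<open>X\<close> and its pendent
      vertices together give \<open>closed_nbhd G X\<close> inside \<open>A\<close>.\<close>
    ultimately have PB: "pverts ?P \<subseteq> B"
      using T(1) by (auto simp: power_dominating_iff[OF P])
    have XA: "X \<subseteq> A"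
      using PB by (auto simp: pendent_ext_def B_def)
    have "nbhd G x - X \<subseteq> A" if "x \<in> X" for x
      using that PB by (auto simp: pendent_ext_def B_def)
    then have NX: "closed_nbhd G X \<subseteq> A"
      using XA by (auto simp: closed_nbhd_subset_iff)
    \<comment> \<open>Putting \<open>None\<close> into \<open>C\<close> is safe whether or not it
      belongs to \<open>D\<close>: all its neighbours come from \<open>closed_nbhd G X\<close> and
      are already in \<open>A\<close>.\<close>
    define C where "C = insert None (Some ` (A - X))"
    have "closed_nbhd ?H D \<subseteq> C"
      unfolding closed_nbhd_subset_iff
    proof (intro conjI ballI)
      have DA: "v \<in> A \<and> nbhd G v \<subseteq> A \<and> v \<notin> X" if "Some v \<in> D" for v
        using A(2) image_eqI[of v the "Some v" "D - {None}"] that DV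
        by (auto simp: closed_nbhd_subset_iff contraction_def)
      show "D \<subseteq> C"
      proof
        fix d assume "d \<in> D"
        then show "d \<in> C" using DA by (cases d) (auto simp: C_def)
      qed
      fix d assume "d \<in> D"
      then show "nbhd ?H d \<subseteq> C"
        using DA NX by (cases d) (auto simp: C_def nbhd_contraction_None nbhd_contraction_Some)
    qed
    moreover have "propagation_closed ?H k C"
      unfolding propagation_closed_def
    proof (intro ballI impI)
      fix d assume d: "d \<in> C" "card (nbhd ?H d - C) \<le> k"
      show "nbhd ?H d \<subseteq> C"
      proof (cases d)
        case None
        then show ?thesis using NX by (auto simp: C_def nbhd_contraction_None)
      next
        case (Some v)
        then have v: "v \<in> A" "v \<notin> X" using d(1) by (auto simp: C_def)
        have "nbhd ?H d - C = Some ` (nbhd G v - A)"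
          using v XA by (auto simp: Some C_def nbhd_contraction_Some)
        then have "card (nbhd G v - A) \<le> k"
          using d(2) by (simp add: card_image)
        then have "nbhd G v \<subseteq> A" using A(1) v by (auto simp: propagation_closed_def)
        then show ?thesis using v by (auto simp: Some C_def nbhd_contraction_Some)
      qed
    qed
    ultimately have "pverts ?H \<subseteq> C"
      using D(1) by (auto simp: power_dominating_iff[OF H])
    then show "pverts G \<subseteq> A"
      using XA by (auto simp: contraction_def C_def)
  qed
  then have "power_dom_num k G \<le> card (?D \<union> ?T)" by (rule power_dom_num_le[OF G])
  also have "\<dots> \<le> card ?D + card ?T" by (rule card_Un_le)
  also have "\<dots> \<le> card D + card T"
    using finD finT by (meson add_mono card_Diff1_le card_image_le finite_Diff le_trans)
  finally show ?thesis using D(2) T(2) by simp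
qed

section \<open>Lower bounds from leaves, and the trees for the tightness examples\<close>

text \<open>The complement of \<open>L\<close> is propagation-closed: only \<open>c\<close> has
  neighbours in \<open>L\<close>, and it misses all of them, which is more than \<open>k\<close>. If
  \<open>S\<close> avoids \<open>c\<close> and \<open>L\<close>, then its closed neighbourhood stays
  in this complement.\<close>

lemma power_dominating_meets_leaves:
  assumes G: "pair_graph G" and S: "power_dominating G k S"
    and L: "L \<subseteq> pverts G" "k < card L" "\<And>v. v \<in> L \<Longrightarrow> nbhd G v = {c}"
  shows "S \<inter> insert c L \<noteq> {}"
proof
  interpret pair_graph G by fact
  assume disj: "S \<inter> insert c L = {}"
  have sym: "v \<in> nbhd G u \<Longrightarrow> u \<in> nbhd G v" for u v
    by (auto simp: nbhd_def intro: arcs_symmetric)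
  have other: "nbhd G v \<inter> L = {}" if "v \<noteq> c" for v
    using that sym L(3) by blast
  have "propagation_closed G k (- L)"
    unfolding propagation_closed_def
  proof (intro ballI impI)
    fix v assume v: "v \<in> - L" "card (nbhd G v - - L) \<le> k"
    show "nbhd G v \<subseteq> - L"
    proof (cases "v = c")
      case True
      have "nbhd G c - - L = L" using sym L(3) by blast
      then show ?thesis using v(2) L(2) True by simp
    qed (use other in blast)
  qed
  moreover have "closed_nbhd G S \<subseteq> - L"
    unfolding closed_nbhd_subset_iff using disj other by blast
  ultimately have "pverts G \<subseteq> - L"
    using S by (auto simp: power_dominating_iff[OF G])
  then show False using L by (metis Int_absorb1 card.empty disjoint_eq_subset_Compl not_less_zero)
qed

lemma two_le_power_dom_num:
  assumes G: "pair_graph G"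
    and L: "L \<subseteq> pverts G" "k < card L" "\<And>v. v \<in> L \<Longrightarrow> nbhd G v = {c}"
    and M: "M \<subseteq> pverts G" "k < card M" "\<And>v. v \<in> M \<Longrightarrow> nbhd G v = {d}"
    and disj: "insert c L \<inter> insert d M = {}"
  shows "2 \<le> power_dom_num k G"
proof -
  obtain S where S: "power_dominating G k S" "card S = power_dom_num k G"
    using power_dom_num_attained[OF G] by blast
  obtain x y where xy: "x \<in> S" "x \<in> insert c L" "y \<in> S" "y \<in> insert d M"
    using power_dominating_meets_leaves[OF G S(1) L] power_dominating_meets_leaves[OF G S(1) M]
    by blast
  then have "x \<noteq> y" using disj by blast
  then have "card {x, y} = 2" by simp
  moreover have "card {x, y} \<le> card S"
    using xy finite_power_dominating[OF G S(1)] by (intro card_mono) auto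
  ultimately show ?thesis using S(2) by simp
qed

text \<open>
  A tree of depth two rooted at \<open>0\<close>: the vertices \<open>1, \<dots>, m - 1\<close> are children of the root, and
  each \<open>i \<ge> m\<close> is a leaf hanging from \<open>i mod m\<close>. With \<open>m = 2\<close> it is a double star.
\<close>

definition tree_parent :: "nat \<Rightarrow> nat \<Rightarrow> nat" where
  "tree_parent m i = (if i < m then 0 else i mod m)"

definition residue_tree :: "nat \<Rightarrow> nat \<Rightarrow> nat pair_pre_digraph" where
  "residue_tree m n = \<lparr> pverts = {..<n},
     parcs = {(i, tree_parent m i) | i. 0 < i \<and> i < n} \<union> {(tree_parent m i, i) | i. 0 < i \<and> i < n} \<rparr>"

lemma pverts_residue_tree [simp]: "pverts (residue_tree m n) = {..<n}"
  by (simp add: residue_tree_def)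

lemma arc_residue_tree_iff:
  "(u, v) \<in> parcs (residue_tree m n) \<longleftrightarrow>
     0 < u \<and> u < n \<and> v = tree_parent m u \<or> 0 < v \<and> v < n \<and> u = tree_parent m v"
  unfolding residue_tree_def by simp blast

text \<open>Excludes loops, keeps parents within the vertex range, and makes the walk to the root a
  well-founded descent.\<close>

lemma tree_parent_less: "0 < m \<Longrightarrow> 0 < i \<Longrightarrow> tree_parent m i < i"
  unfolding tree_parent_def by (smt (verit) mod_less_divisor not_le_imp_less order_less_le_trans)

lemma pair_graph_residue_tree:
  assumes "0 < m"
  shows "pair_graph (residue_tree m n)"
proof (rule pair_graphI)
  have less: "tree_parent m i < n" if "0 < i" "i < n" for i
    using tree_parent_less[OF assms that(1)] that(2) by simp
  show "parcs (residue_tree m n) \<subseteq> pverts (residue_tree m n) \<times> pverts (residue_tree m n)"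
    unfolding residue_tree_def pair_pre_digraph.simps lessThan_def using less by blast
  show "irrefl (parcs (residue_tree m n))"
    unfolding irrefl_def arc_residue_tree_iff using tree_parent_less[OF assms] by (metis less_irrefl)
  show "sym (parcs (residue_tree m n))"
    unfolding residue_tree_def pair_pre_digraph.simps by (rule symI) blast
qed simp

text \<open>Every parent is smaller than \<open>m\<close>, so a vertex \<open>i \<ge> m\<close> has
  no children.\<close>

lemma nbhd_residue_tree_leaf:
  assumes "0 < m" "m \<le> i" "i < n"
  shows "nbhd (residue_tree m n) i = {i mod m}"
proof -
  have "i \<noteq> tree_parent m j" for j
    using assms mod_less_divisor[of m j] by (auto simp: tree_parent_def simp del: mod_less_divisor)
  then show ?thesis using assms by (auto simp: nbhd_def residue_tree_def tree_parent_def[of m i])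
qed

lemma connected_residue_tree:
  assumes "0 < m" "0 < n"
  shows "Digraph_Component.connected (with_proj (residue_tree m n))"
proof -
  let ?G = "residue_tree m n"
  interpret pair_graph ?G by (rule pair_graph_residue_tree[OF assms(1)])
  have to_root: "i \<rightarrow>\<^sup>*\<^bsub>?G\<^esub> 0" if "i < n" for i
    using that
  proof (induction i rule: less_induct)
    case (less i)
    show ?case
    proof (cases "i = 0")
      case True
      have "0 \<in> pverts ?G" using assms(2) by simp
      then show ?thesis unfolding True by (rule reachable_refl)
    next
      case False
      then have less_i: "tree_parent m i < i" by (intro tree_parent_less assms(1)) simp
      have "(i, tree_parent m i) \<in> parcs ?G"
        using False less.prems by (simp add: arc_residue_tree_iff)
      moreover have "tree_parent m i \<rightarrow>\<^sup>*\<^bsub>?G\<^esub> 0"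
        by (rule less.IH[OF less_i order.strict_trans[OF less_i less.prems]])
      ultimately show ?thesis by (rule adj_reachable_trans)
    qed
  qed
  show ?thesis
    unfolding Digraph_Component.connected_def
  proof (rule strongly_connectedI)
    have "0 \<in> verts (mk_symmetric ?G)" using assms(2) by simp
    then show "verts (mk_symmetric ?G) \<noteq> {}" by blast
    fix u v assume "u \<in> verts (mk_symmetric ?G)" "v \<in> verts (mk_symmetric ?G)"
    then have "u < n" "v < n" by simp_all
    then show "u \<rightarrow>\<^sup>*\<^bsub>mk_symmetric ?G\<^esub> v"
      by (intro reachable_mk_symmetricI reachable_trans[OF to_root symmetric_reachable'[OF to_root]])
  qed
qed

section \<open>Tightness of both bounds\<close>

lemma power_dom_num_le_card_dominating:
  assumes "pair_graph G" and "S \<subseteq> pverts G" and "pverts G \<subseteq> closed_nbhd G S"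
  shows "power_dom_num k G \<le> card S"
  using assms power_dom_num_le[OF assms(1)] by (metis power_dominating_iff order_trans)

lemma upper_bound_tight:
  "\<exists>(G :: nat pair_pre_digraph) X.
     pair_graph G \<and> Digraph_Component.connected (with_proj G) \<and> X \<subseteq> pverts G \<and> X \<noteq> {} \<and>
     power_dom_num k G = power_dom_num k (contraction G X) + power_dom_num k (pendent_ext G X)"
proof -
  \<comment> \<open>The centres are 0 and 1; each of the parity classes in 2, ..., 2k + 3 supplies
    \<open>k + 1\<close> leaves. \<open>?X\<close> is the star at 1.\<close>
  let ?G = "residue_tree 2 (2 * k + 4)"
  let ?X = "{i. i < 2 * k + 4 \<and> odd i}"
  have G: "pair_graph ?G" by (rule pair_graph_residue_tree) simp
  have X: "?X \<subseteq> pverts ?G" by (auto simp: residue_tree_def)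
  have leaf: "nbhd ?G i = {i mod 2}" if "2 \<le> i" "i < 2 * k + 4" for i
    using that by (intro nbhd_residue_tree_leaf) auto
  have "2 \<le> power_dom_num k ?G"
  proof (rule two_le_power_dom_num[OF G])
    show "k < card ((\<lambda>j. 2 * j) ` {1..k + 1})"
      by (subst card_image) (auto simp: inj_on_def)
    show "k < card ((\<lambda>j. 2 * j + 1) ` {1..k + 1})"
      by (subst card_image) (auto simp: inj_on_def)
    show "nbhd ?G i = {0}" if "i \<in> (\<lambda>j. 2 * j) ` {1..k + 1}" for i
      using that leaf by auto
    show "nbhd ?G i = {1}" if "i \<in> (\<lambda>j. 2 * j + 1) ` {1..k + 1}" for i
      using that leaf by auto
    show "insert 0 ((\<lambda>j. 2 * j) ` {1..k + 1}) \<inter> insert (1::nat) ((\<lambda>j. 2 * j + 1) ` {1..k + 1}) = {}"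
      by (auto, presburger+)
  qed (auto simp: residue_tree_def)
  \<comment> \<open>The only neighbour of \<open>None\<close> is 0, so the contraction is a star
    centred at \<open>Some 0\<close>.\<close>
  moreover have "power_dom_num k (contraction ?G ?X) \<le> card {Some (0::nat)}"
  proof (rule power_dom_num_le_card_dominating[OF pair_graph_contraction[OF G X]])
    have "(0, i) \<in> parcs ?G" if "even i" "0 < i" "i < 2 * k + 4" for i
      using that by (auto simp: residue_tree_def tree_parent_def)
    moreover have "(1, 0) \<in> parcs ?G" by (auto simp: residue_tree_def tree_parent_def)
    then have "0 \<in> closed_nbhd ?G ?X - ?X"
      unfolding closed_nbhd_def nbhd_def by (auto intro!: exI[of _ 1])
    ultimately show "pverts (contraction ?G ?X) \<subseteq> closed_nbhd (contraction ?G ?X) {Some 0}"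
      by (auto simp: closed_nbhd_subset_iff contraction_def closed_nbhd_def[of _ "{Some 0}"] nbhd_def[of _ "Some 0"])
  qed (auto simp: contraction_def residue_tree_def)
  moreover have "power_dom_num k (pendent_ext ?G ?X) \<le> card {Inl 1 :: nat + nat \<times> nat}"
  proof (rule power_dom_num_le_card_dominating[OF pair_graph_pendent_ext[OF G X]])
    have one: "(1, i) \<in> parcs ?G" if "odd i" "i \<noteq> 1" "i < 2 * k + 4" for i
    proof -
      have "2 \<le> i" "i mod 2 = 1" using that(1,2) by presburger+
      then show ?thesis using that(3) by (auto simp: residue_tree_def tree_parent_def)
    qed
    \<comment> \<open>Only the centre 1 has a neighbour outside \<open>?X\<close>, so the pendent
      extension is again a star, dominated by \<open>Inl 1\<close>.\<close>
    have outer: "x = 1" if x: "x \<in> ?X" and y: "y \<in> nbhd ?G x - ?X" for x y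
    proof (rule ccontr)
      assume "x \<noteq> 1"
      have "odd x" "x < 2 * k + 4" using x by auto
      then have "2 \<le> x" "x mod 2 = 1" using \<open>x \<noteq> 1\<close> by presburger+
      then have "nbhd ?G x = {1}" using leaf[of x] \<open>x < 2 * k + 4\<close> by simp
      then show False using y by auto
    qed
    show "pverts (pendent_ext ?G ?X) \<subseteq> closed_nbhd (pendent_ext ?G ?X) {Inl 1}"
    proof
      fix p assume p: "p \<in> pverts (pendent_ext ?G ?X)"
      show "p \<in> closed_nbhd (pendent_ext ?G ?X) {Inl 1}"
      proof (cases p)
        case (Inl x)
        then have "x \<in> ?X" using p by (auto simp: pendent_ext_def)
        then show ?thesis
          using Inl one[of x] by (cases "x = 1") (simp_all add: closed_nbhd_def nbhd_def pendent_ext_def)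
      next
        case (Inr q)
        then obtain x y where q: "q = (x, y)" "x \<in> ?X" "y \<in> nbhd ?G x - ?X"
          using p by (auto simp: pendent_ext_def)
        then have "x = 1" using outer by blast
        then show ?thesis
          using Inr q by (simp add: closed_nbhd_def nbhd_def pendent_ext_def)
      qed
    qed
  qed (auto simp: pendent_ext_def)
  \<comment> \<open>The general inequality closes the chain: the number for \<open>?G\<close> is at
    least 2, the sum at most 2.\<close>
  moreover have "power_dom_num k ?G \<le> power_dom_num k (contraction ?G ?X) + power_dom_num k (pendent_ext ?G ?X)"
    by (rule power_dom_num_le_contraction[OF G X])
  ultimately have "power_dom_num k ?G = power_dom_num k (contraction ?G ?X) + power_dom_num k (pendent_ext ?G ?X)"
    by simp
  moreover have "Digraph_Component.connected (with_proj ?G)" by (rule connected_residue_tree) auto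
  moreover have "1 \<in> ?X" by auto
  ultimately show ?thesis using G X by blast
qed

lemma lower_bound_tight:
  assumes "1 \<le> k"
  shows "\<exists>(G :: nat pair_pre_digraph) X.
     pair_graph G \<and> Digraph_Component.connected (with_proj G) \<and> X \<subseteq> pverts G \<and> X \<noteq> {} \<and>
     int (power_dom_num k G) = int (power_dom_num k (contraction G X)) - 1"
proof -
  \<comment> \<open>Among the leaves 3, ..., 3k + 3 the residue 0 occurs \<open>k + 1\<close> times
    and the residues 1 and 2 occur \<open>k\<close> times each.\<close>
  let ?G = "residue_tree 3 (3 * k + 4)"
  let ?X = "{1, 2} :: nat set"
  have G: "pair_graph ?G" by (rule pair_graph_residue_tree) simp
  have X: "?X \<subseteq> pverts ?G" by (auto simp: residue_tree_def)
  have leaf: "nbhd ?G i = {i mod 3}" if "3 \<le> i" "i < 3 * k + 4" for i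
    using that by (intro nbhd_residue_tree_leaf) auto
  have "power_dominating ?G k {0}"
    unfolding power_dominating_iff[OF G]
  proof (intro conjI allI impI)
    show "{0} \<subseteq> pverts ?G" by (auto simp: residue_tree_def)
    fix A assume A: "propagation_closed ?G k A" "closed_nbhd ?G {0} \<subseteq> A"
    have tp: "i \<in> nbhd ?G (tree_parent 3 i)" if "0 < i" "i < 3 * k + 4" for i
      using that by (auto simp: residue_tree_def nbhd_def)
    have A0: "0 \<in> A" "nbhd ?G 0 \<subseteq> A" using A(2) by (auto simp: closed_nbhd_def)
    have rA: "nbhd ?G r \<subseteq> A" if r: "r \<in> {1, 2}" for r
    proof -
      have "tree_parent 3 r = 0" using r by (auto simp: tree_parent_def)
      then have "r \<in> A" using A0 tp[of r] r assms by auto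
      \<comment> \<open>The root is in \<open>A\<close>, so the child \<open>r\<close> can miss only
        its own \<open>k\<close> leaves \<open>3 * j + r\<close> and may propagate.\<close>
      have "nbhd ?G r - A \<subseteq> (\<lambda>j. 3 * j + r) ` {1..k}"
      proof
        fix i assume i: "i \<in> nbhd ?G r - A"
        then have "i < 3 * k + 4" "i \<noteq> 0" and e: "r = tree_parent 3 i \<or> i = tree_parent 3 r"
          using A0 nbhd_subset[OF G] by (auto simp: nbhd_def residue_tree_def)
        with \<open>tree_parent 3 r = 0\<close> have "r = tree_parent 3 i" by auto
        then have "3 \<le> i" "i mod 3 = r" using r by (auto simp: tree_parent_def split: if_splits)
        moreover have "i = 3 * (i div 3) + i mod 3" by presburger
        ultimately have "i = 3 * (i div 3) + r" "1 \<le> i div 3" "i div 3 \<le> k"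
          using \<open>i < 3 * k + 4\<close> r unfolding insert_iff empty_iff by presburger+
        then show "i \<in> (\<lambda>j. 3 * j + r) ` {1..k}" by (metis atLeastAtMost_iff imageI)
      qed
      then have "card (nbhd ?G r - A) \<le> card ((\<lambda>j. 3 * j + r) ` {1..k})"
        by (intro card_mono) auto
      also have "\<dots> \<le> k" using card_image_le[of "{1..k}" "\<lambda>j. 3 * j + r"] by simp
      finally show ?thesis using A(1) \<open>r \<in> A\<close> by (auto simp: propagation_closed_def)
    qed
    show "pverts ?G \<subseteq> A"
    proof
      fix i assume "i \<in> pverts ?G"
      then have i: "i < 3 * k + 4" by (simp add: residue_tree_def)
      have "tree_parent 3 i \<in> {0, 1, 2}" by (auto simp: tree_parent_def)
      then have "nbhd ?G (tree_parent 3 i) \<subseteq> A" using rA A0 by auto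
      then show "i \<in> A" using tp[of i] i A0 by (cases "i = 0") auto
    qed
  qed
  then have "power_dom_num k ?G \<le> 1" using power_dom_num_le[OF G] by fastforce
  moreover have "2 \<le> power_dom_num k (contraction ?G ?X)"
  proof -
    define L where "L = (\<lambda>j::nat. 3 * j) ` {1..k + 1}"
    \<comment> \<open>The \<open>k\<close> leaves of 1 and one leaf of 2, namely 5, which is a
      vertex because \<open>k \<ge> 1\<close>. In the contraction all of these hang from
      \<open>None\<close>.\<close>
    define M where "M = insert 5 ((\<lambda>j::nat. 3 * j + 1) ` {1..k})"
    have "card L = k + 1" unfolding L_def by (subst card_image) (auto simp: inj_on_def)
    then have L_card: "k < card (Some ` L)" by (simp add: card_image)
    have "5 \<noteq> 3 * j + 1" for j :: nat by presburger
    then have "card M = k + 1"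
      unfolding M_def by (subst card_insert_disjoint) (auto simp: card_image inj_on_def)
    then have M_card: "k < card (Some ` M)" by (simp add: card_image)
    have L: "3 \<le> i" "i < 3 * k + 4" "i mod 3 = 0" if "i \<in> L" for i
      using that by (auto simp: L_def)
    have M: "3 \<le> i" "i < 3 * k + 4" "i mod 3 = 1 \<or> i mod 3 = 2" if "i \<in> M" for i
      using that assms by (auto simp: M_def)
    \<comment> \<open>Decides which leaves of \<open>?G\<close> become adjacent to
      \<open>None\<close>: those with nonzero residue, while the multiples of 3 stay attached to the
      root.\<close>
    have N: "i \<in> closed_nbhd ?G ?X \<longleftrightarrow> i mod 3 = 1 \<or> i mod 3 = 2" if "3 \<le> i" "i < 3 * k + 4" for i
    proof -
      have "i \<in> nbhd ?G r \<longleftrightarrow> i mod 3 = r" for r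
      proof -
        have "i \<in> nbhd ?G r \<longleftrightarrow> r \<in> nbhd ?G i"
          by (auto simp: nbhd_def residue_tree_def)
        also have "\<dots> \<longleftrightarrow> i mod 3 = r" unfolding leaf[OF that] by blast
        finally show ?thesis .
      qed
      then show ?thesis using that(1) by (auto simp: closed_nbhd_def)
    qed
    show ?thesis
    proof (rule two_le_power_dom_num[OF pair_graph_contraction[OF G X] _ L_card _ _ M_card])
      show "nbhd (contraction ?G ?X) v = {Some 0}" if v: "v \<in> Some ` L" for v
      proof -
        obtain i where i: "v = Some i" "i \<in> L" using v by blast
        then show ?thesis
          using L[OF i(2)] N[of i] leaf[of i] by (simp add: nbhd_contraction_Some)
      qed
      show "nbhd (contraction ?G ?X) v = {None}" if v: "v \<in> Some ` M" for v
      proof -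
        obtain i where i: "v = Some i" "i \<in> M" using v by blast
        then show ?thesis
          using M[OF i(2)] N[of i] leaf[of i] by (auto simp: nbhd_contraction_Some)
      qed
      have "L \<inter> M = {}"
      proof (rule equals0I)
        fix i assume "i \<in> L \<inter> M"
        then show False using L(3)[of i] M(3)[of i] by auto
      qed
      moreover have "0 \<notin> M" using M(1)[of 0] by auto
      ultimately show "insert (Some 0) (Some ` L) \<inter> insert None (Some ` M) = {}" by blast
      have "i \<in> {..<3 * k + 4} - ?X" if "i \<in> L \<union> M" for i
        using that L(1,2)[of i] M(1,2)[of i] by auto
      then show "Some ` L \<subseteq> pverts (contraction ?G ?X)" "Some ` M \<subseteq> pverts (contraction ?G ?X)"
        by (auto simp: contraction_def)
    qed
  qed
  moreover have "power_dom_num k (contraction ?G ?X) \<le> power_dom_num k ?G + 1"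
    by (rule power_dom_num_contraction_le[OF G X])
  ultimately have "int (power_dom_num k ?G) = int (power_dom_num k (contraction ?G ?X)) - 1"
    by simp
  moreover have "Digraph_Component.connected (with_proj ?G)" by (rule connected_residue_tree) auto
  ultimately show ?thesis using G X by blast
qed

theorem theorem4p4:
  shows "(\<forall>(k :: nat) (G :: 'a pair_pre_digraph) X.
       pair_graph G \<and> Digraph_Component.connected (with_proj G) \<and> X \<subseteq> pverts G \<longrightarrow>
         int (power_dom_num k (contraction G X)) - 1 \<le> int (power_dom_num k G) \<and>
         power_dom_num k G \<le> power_dom_num k (contraction G X) + power_dom_num k (pendent_ext G X))
   \<and> (\<forall>k::nat. k \<ge> 1 \<longrightarrow>
       (\<exists>(G :: nat pair_pre_digraph) X.
         pair_graph G \<and> Digraph_Component.connected (with_proj G) \<and> X \<subseteq> pverts G \<and> X \<noteq> {} \<and>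
         power_dom_num k G = power_dom_num k (contraction G X) + power_dom_num k (pendent_ext G X)) \<and>
       (\<exists>(G :: nat pair_pre_digraph) X.
         pair_graph G \<and> Digraph_Component.connected (with_proj G) \<and> X \<subseteq> pverts G \<and> X \<noteq> {} \<and>
         int (power_dom_num k G) = int (power_dom_num k (contraction G X)) - 1))"
proof (intro conjI allI impI)
  fix k :: nat and G :: "'a pair_pre_digraph" and X
  assume "pair_graph G \<and> Digraph_Component.connected (with_proj G) \<and> X \<subseteq> pverts G"
  then have G: "pair_graph G" "X \<subseteq> pverts G" by auto
  show "int (power_dom_num k (contraction G X)) - 1 \<le> int (power_dom_num k G)"
    using power_dom_num_contraction_le[OF G, of k] by simp
  show "power_dom_num k G \<le> power_dom_num k (contraction G X) + power_dom_num k (pendent_ext G X)"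
    by (rule power_dom_num_le_contraction[OF G])
qed (rule upper_bound_tight, erule lower_bound_tight)

end
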